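(* For all integers $s\ge 50000$ and $q_0$ such that $20s\le q_0\le \frac{s^2}{200\log s}$, there exists an integer $q$ with $|q-q_0|\le s$ such that Lazebnik's conjecture is false for $(s,q)$.
   Context: Graphs are finite and simple; $\log$ is the natural logarithm. $P_G(q)$ denotes the number of proper $q$-colorings of $G$. $T_s(n)$ denotes the balanced Turán graph: the complete $s$-partite graph on $n$ vertices with nearly equal parts (sizes differing by at most one). Lazebnik's conjecture for a pair of integers $(s,q)$ with $q\ge s>1$ is the assertion: for every positive integer $n$ divisible by $s$, the Turán graph $T_s(n)$ has more proper $q$-colorings than any other graph with the same number of vertices and edges. Thus it is false for $(s,q)$ if there are $n$ divisible by $s$ and a graph $G$, not isomorphic to $T_s(n)$, with $n$ vertices and the same number of edges as $T_s(n)$, such that $P_G(q)\ge P_{T_s(n)}(q)$. *)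

theory Defs
  imports Complex_Main "HOL-Library.FuncSet"
    "Graph_Theory.Pair_Digraph" "Graph_Theory.Digraph_Isomorphism"
begin

text \<open>
  Finite simple graphs are \<open>pair_graph\<close>s, that is, symmetric loop-free finite digraphs without
  parallel arcs. Every undirected edge is stored as two opposite arcs, so edges are counted as
  unordered pairs.
\<close>

definition edge_set :: "'a pair_pre_digraph \<Rightarrow> 'a set set" where
  "edge_set G = {{u, v} | u v. (u, v) \<in> parcs G}"

definition isomorphic :: "'a pair_pre_digraph \<Rightarrow> 'b pair_pre_digraph \<Rightarrow> bool" where
  "isomorphic G H \<longleftrightarrow> digraph_iso (with_proj G) (with_proj H)"

text \<open>
  Colourings are extensional functions, i.e. fixed to \<open>undefined\<close> outside the vertex set, so that
  each of them is counted once.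
\<close>

definition proper_colorings :: "'a pair_pre_digraph \<Rightarrow> nat \<Rightarrow> ('a \<Rightarrow> nat) set" where
  "proper_colorings G q =
     {c \<in> pverts G \<rightarrow>\<^sub>E {..<q}. \<forall>(u, v) \<in> parcs G. c u \<noteq> c v}"

definition num_colorings :: "'a pair_pre_digraph \<Rightarrow> nat \<Rightarrow> nat" where
  "num_colorings G q = card (proper_colorings G q)"

text \<open>The parts of the Turan graph are the residue classes modulo \<open>s\<close> in \<open>{0, ..., n - 1}\<close>.\<close>

definition turan_graph :: "nat \<Rightarrow> nat \<Rightarrow> nat pair_pre_digraph" where
  "turan_graph s n =
     \<lparr>pverts = {..<n}, parcs = {(u, v). u < n \<and> v < n \<and> u mod s \<noteq> v mod s}\<rparr>"

text \<open>
  Every finite graph is isomorphic to one whose vertices are natural numbers, so it is no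
  restriction to let \<open>G\<close> range over these.
\<close>

definition lazebnik_conjecture :: "nat \<Rightarrow> nat \<Rightarrow> bool" where
  "lazebnik_conjecture s q \<longleftrightarrow>
     (\<forall>n > 0. s dvd n \<longrightarrow>
       (\<forall>G :: nat pair_pre_digraph.
          pair_graph G \<and>
          card (pverts G) = card (pverts (turan_graph s n)) \<and>
          card (edge_set G) = card (edge_set (turan_graph s n)) \<and>
          \<not> isomorphic G (turan_graph s n)
          \<longrightarrow> num_colorings G q < num_colorings (turan_graph s n) q))"

lemma pair_graph_turan_graph: "pair_graph (turan_graph s n)"
proof -
  have "finite {(u, v). u < n \<and> v < n \<and> u mod s \<noteq> v mod s}"
    by (rule finite_subset[of _ "{..<n} \<times> {..<n}"]) auto
  then show ?thesis
    by unfold_locales (auto simp: turan_graph_def symmetric_def sym_def)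
qed

lemma card_pverts_turan_graph [simp]: "card (pverts (turan_graph s n)) = n"
  by (simp add: turan_graph_def)

lemma turan_graph_part_size:
  assumes "s dvd n" "i < s"
  shows "card {v \<in> pverts (turan_graph s n). v mod s = i} = n div s"
proof -
  obtain k where k: "n = s * k" using assms(1) by blast
  have "{v \<in> pverts (turan_graph s n). v mod s = i} = (\<lambda>j. s * j + i) ` {..<k}"
  proof (intro equalityI subsetI)
    fix v assume "v \<in> {v \<in> pverts (turan_graph s n). v mod s = i}"
    then have v: "v < s * k" "v mod s = i" by (auto simp: turan_graph_def k)
    have "v div s < k" using v(1) by (simp add: less_mult_imp_div_less mult.commute)
    moreover have "v = s * (v div s) + i" using v(2) by (metis mult_div_mod_eq)
    ultimately show "v \<in> (\<lambda>j. s * j + i) ` {..<k}" by blast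
  next
    fix v assume "v \<in> (\<lambda>j. s * j + i) ` {..<k}"
    then obtain j where j: "j < k" "v = s * j + i" by auto
    have "s * j + i < s * Suc j" using assms(2) by simp
    also have "\<dots> \<le> s * k" using j(1) by (intro mult_le_mono) auto
    finally show "v \<in> {v \<in> pverts (turan_graph s n). v mod s = i}"
      using j assms(2) by (simp add: turan_graph_def k)
  qed
  moreover have "inj_on (\<lambda>j. s * j + i) {..<k}"
    using assms(2) by (auto simp: inj_on_def)
  ultimately show ?thesis using assms(2) by (simp add: card_image k)
qed

lemma isomorphic_iff:
  assumes "pair_wf_digraph G"
  shows "isomorphic G H \<longleftrightarrow>
    (\<exists>f. bij_betw f (pverts G) (pverts H) \<and> parcs H = map_prod f f ` parcs G)"
proof
  assume "isomorphic G H"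
  then obtain h where h: "pre_digraph.digraph_isomorphism (with_proj G) h"
    "with_proj H = app_iso h (with_proj G)"
    by (auto simp: isomorphic_def digraph_iso_def)
  let ?f = "iso_verts h"
  have eqs: "pverts H = ?f ` pverts G" "parcs H = iso_arcs h ` parcs G"
    "iso_tail h = fst" "iso_head h = snd"
    using h(2) by (auto simp: with_proj_def app_iso_def)
  have "iso_arcs h a = map_prod ?f ?f a" if "a \<in> parcs G" for a
    using h(1) that eqs(3,4)
    by (auto simp: pre_digraph.digraph_isomorphism_def prod_eq_iff)
  then have "parcs H = map_prod ?f ?f ` parcs G" using eqs(2) by force
  moreover have "bij_betw ?f (pverts G) (pverts H)"
    using h(1) eqs(1) by (auto simp: pre_digraph.digraph_isomorphism_def bij_betw_def)
  ultimately show "\<exists>f. bij_betw f (pverts G) (pverts H) \<and> parcs H = map_prod f f ` parcs G"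
    by blast
next
  assume "\<exists>f. bij_betw f (pverts G) (pverts H) \<and> parcs H = map_prod f f ` parcs G"
  then obtain f where f: "bij_betw f (pverts G) (pverts H)" "parcs H = map_prod f f ` parcs G"
    by blast
  let ?h = "\<lparr>iso_verts = f, iso_arcs = map_prod f f, iso_head = snd, iso_tail = fst\<rparr>"
  have "inj_on (map_prod f f) (pverts G \<times> pverts G)"
    using f(1) by (intro map_prod_inj_on) (auto simp: bij_betw_def)
  moreover have "parcs G \<subseteq> pverts G \<times> pverts G"
    using pair_wf_digraph.in_arcsD1[OF assms] pair_wf_digraph.in_arcsD2[OF assms] by auto
  ultimately have "inj_on (map_prod f f) (parcs G)"
    by (rule inj_on_subset)
  then have "pre_digraph.digraph_isomorphism (with_proj G) ?h"
    using f(1) assms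
    by (auto simp: pre_digraph.digraph_isomorphism_def wf_digraph_wp_iff bij_betw_def)
  moreover have "with_proj H = app_iso ?h (with_proj G)"
    using f by (auto simp: with_proj_def app_iso_def bij_betw_def)
  ultimately show "isomorphic G H"
    unfolding isomorphic_def digraph_iso_def by blast
qed

end

theory Submission
  imports Defs
begin

text \<open>
  When \<open>q\<close> is not a multiple of \<open>s\<close>, the Turan graph is badly matched to the palette: its parts have
  equal size, but whole colours have to be distributed, so with \<open>q = s * t + r + 1\<close> some parts get
  \<open>t + 1\<close> colours and the others only \<open>t\<close>. For \<open>r\<close> close to \<open>s / 2\<close> this is as wasteful as possible.
  A complete multipartite graph gains by moving vertices from the parts with \<open>t\<close> colours to
  those with \<open>t + 1\<close> colours. Unequal parts lose edges, and one additional small part, coloured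
  with a single colour, wins them back.

  Concretely, scale the vertex number to \<open>s\<^sup>2\<close>. The Turan graph has \<open>s\<close> parts of size \<open>s\<close>, and the
  competitor has \<open>r\<close> parts of size \<open>s + 4\<close>, \<open>s - r\<close> parts of size \<open>s - 4\<close> and one part of size
  \<open>y = 4 * (s - 2 * r)\<close>. If \<open>s - 2 * r\<close> is \<open>3\<close> or \<open>4\<close>, the sum of the squares of the part sizes is at
  most \<open>s * s\<^sup>2\<close>, so the competitor has at least as many edges. Write \<open>\<rho> = 1 + 1 / t\<close>. Up to a
  factor \<open>s ^ q\<close>, the Turan graph has at most \<open>t ^ (s * s) * \<rho> ^ (s * (r + 1))\<close> colourings. The
  competitor has at least \<open>t ^ (s * s - y) * \<rho> ^ (r * (s + 4))\<close>, which is larger if and only if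
  \<open>t ^ y < \<rho> ^ (4 * r - s)\<close>. Here \<open>y \<le> 16\<close> and \<open>4 * r - s\<close> is about \<open>s\<close>, while \<open>ln \<rho>\<close> is about
  \<open>1 / t\<close>, so the condition amounts to \<open>t * ln t\<close> being less than a constant multiple of \<open>s\<close>. This is
  where the bound on the number of colours comes from.

  Blowing up every part by a large factor \<open>M\<close> raises the two main terms to the power \<open>M\<close> but leaves
  the factor \<open>s ^ q\<close> in \<open>num_colorings_turan_graph_le\<close> unchanged, so the comparison of the main
  terms decides (\<open>not_lazebnik_conjecture_if_power_less\<close>). Superfluous edges of the
  competitor are simply deleted (\<open>not_lazebnik_conjectureI\<close>).
\<close>


section \<open>Deleting edges from a graph with too many colourings\<close>

lemma card_parcs_eq_twice_card_edge_set:
  assumes "pair_graph G"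
  shows "card (parcs G) = 2 * card (edge_set G)"
proof -
  interpret pair_graph G by (fact assms)
  have edge_set: "edge_set G = (\<lambda>(u, v). {u, v}) ` parcs G"
    by (auto simp: edge_set_def)
  have fibre: "card {a \<in> parcs G. (\<lambda>(u, v). {u, v}) a = e} = 2" if "e \<in> edge_set G" for e
  proof -
    from that obtain u v where uv: "(u, v) \<in> parcs G" "e = {u, v}"
      by (auto simp: edge_set_def)
    have "(v, u) \<in> parcs G" using uv(1) by (simp add: arcs_symmetric)
    moreover have "u \<noteq> v" using uv(1) by (rule no_loops')
    ultimately have "{a \<in> parcs G. (\<lambda>(u, v). {u, v}) a = e} = {(u, v), (v, u)}"
      using uv by (auto simp: doubleton_eq_iff)
    then show ?thesis using \<open>u \<noteq> v\<close> by simp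
  qed
  have "card (parcs G) = (\<Sum>a\<in>parcs G. 1)" by simp
  also have "\<dots> = (\<Sum>e\<in>edge_set G. card {a \<in> parcs G. (\<lambda>(u, v). {u, v}) a = e})"
    unfolding edge_set by (subst sum.image_gen[OF pair_finite_arcs, where g = "\<lambda>(u, v). {u, v}"]) simp
  also have "\<dots> = 2 * card (edge_set G)" using fibre by simp
  finally show ?thesis .
qed

lemma finite_proper_colorings:
  assumes "finite (pverts G)"
  shows "finite (proper_colorings G q)"
proof (rule finite_subset)
  show "proper_colorings G q \<subseteq> pverts G \<rightarrow>\<^sub>E {..<q}"
    by (auto simp: proper_colorings_def)
qed (use assms in \<open>simp add: finite_PiE\<close>)

lemma num_colorings_le_if_isomorphic:
  assumes G: "pair_graph G" and H: "pair_graph H" and iso: "isomorphic G H"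
  shows "num_colorings G q \<le> num_colorings H q"
proof -
  interpret G: pair_graph G by (fact G)
  interpret H: pair_graph H by (fact H)
  obtain f where f: "bij_betw f (pverts G) (pverts H)" "parcs H = map_prod f f ` parcs G"
    using iffD1[OF isomorphic_iff[OF G.pair_wf_digraph_axioms] iso] by blast
  define g where "g = inv_into (pverts G) f"
  have g: "g (f v) = v" if "v \<in> pverts G" for v
    using f(1) that unfolding g_def by (simp add: bij_betw_def)
  have g_in: "g w \<in> pverts G" if "w \<in> pverts H" for w
    using bij_betw_inv_into[OF f(1)] that unfolding g_def by (rule bij_betw_apply)
  define \<phi> where "\<phi> = (\<lambda>c :: _ \<Rightarrow> nat. \<lambda>w\<in>pverts H. c (g w))"
  have f_in: "f v \<in> pverts H" if "v \<in> pverts G" for v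
    using f(1) that by (rule bij_betw_apply)
  have "inj_on \<phi> (proper_colorings G q)"
  proof (rule inj_onI)
    fix c d assume cd: "c \<in> proper_colorings G q" "d \<in> proper_colorings G q" "\<phi> c = \<phi> d"
    have "c v = d v" if "v \<in> pverts G" for v
      using fun_cong[OF cd(3), of "f v"] g f_in that by (simp add: \<phi>_def)
    moreover have "c \<in> pverts G \<rightarrow>\<^sub>E {..<q}" "d \<in> pverts G \<rightarrow>\<^sub>E {..<q}"
      using cd(1,2) by (simp_all add: proper_colorings_def)
    ultimately show "c = d" by (intro PiE_ext)
  qed
  moreover have "\<phi> ` proper_colorings G q \<subseteq> proper_colorings H q"
  proof (intro image_subsetI)
    fix c assume "c \<in> proper_colorings G q"
    then have range: "c \<in> pverts G \<rightarrow>\<^sub>E {..<q}"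
      and proper: "\<And>u v. (u, v) \<in> parcs G \<Longrightarrow> c u \<noteq> c v"
      by (auto simp: proper_colorings_def)
    have "\<phi> c w < q" if "w \<in> pverts H" for w
      using PiE_mem[OF range g_in[OF that]] that by (simp add: \<phi>_def)
    then have "\<phi> c \<in> pverts H \<rightarrow>\<^sub>E {..<q}"
      by (auto simp: PiE_iff \<phi>_def)
    moreover have "\<phi> c w \<noteq> \<phi> c x" if "(w, x) \<in> parcs H" for w x
    proof -
      have "(w, x) \<in> map_prod f f ` parcs G" using that f(2) by simp
      then obtain u v where uv: "(u, v) \<in> parcs G" "w = f u" "x = f v" by auto
      have "u \<in> pverts G" "v \<in> pverts G" using G.in_arcsD1[OF uv(1)] G.in_arcsD2[OF uv(1)] .
      then show ?thesis using proper[OF uv(1)] by (simp add: uv(2,3) \<phi>_def f_in g)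
    qed
    ultimately show "\<phi> c \<in> proper_colorings H q"
      by (simp add: proper_colorings_def split_beta)
  qed
  ultimately show ?thesis
    unfolding num_colorings_def
    by (rule card_inj_on_le) (simp add: finite_proper_colorings)
qed

text \<open>
  Deleting edges cannot destroy a proper colouring, so a counterexample may have more edges than the
  Turan graph; and since it has strictly more colourings, it cannot be isomorphic to it.
\<close>

lemma not_lazebnik_conjectureI:
  fixes H :: "nat pair_pre_digraph"
  assumes n: "0 < n" "s dvd n"
    and H: "pair_graph H" "card (pverts H) = n"
    and edges: "card (edge_set (turan_graph s n)) \<le> card (edge_set H)"
    and colorings: "num_colorings (turan_graph s n) q < num_colorings H q"
  shows "\<not> lazebnik_conjecture s q"
proof -
  interpret H: pair_graph H by (fact H(1))
  obtain F where F: "F \<subseteq> edge_set H" "card F = card (edge_set (turan_graph s n))"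
    using obtain_subset_with_card_n[OF edges] by blast
  define G where "G = \<lparr>pverts = pverts H, parcs = {(u, v). {u, v} \<in> F}\<rparr>"
  have sub: "parcs G \<subseteq> parcs H"
  proof (clarsimp simp: G_def)
    fix u v assume "{u, v} \<in> F"
    then obtain x y where "{u, v} = {x, y}" "(x, y) \<in> parcs H"
      using F(1) by (auto simp: edge_set_def)
    then show "(u, v) \<in> parcs H" by (auto simp: doubleton_eq_iff H.arcs_symmetric)
  qed
  have [simp]: "pverts G = pverts H" by (simp add: G_def)
  have "pair_graph G"
  proof unfold_locales
    show "finite (pverts G)" by simp
    show "finite (parcs G)" using sub H.pair_finite_arcs by (rule finite_subset)
    have "{v, u} = {u, v}" for u v :: nat by blast
    then show "symmetric (with_proj G)"
      by (simp add: symmetric_def sym_def G_def)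
    show "fst a \<in> pverts G" "snd a \<in> pverts G" if "a \<in> parcs G" for a
      using sub that H.in_arcsD1[of "fst a" "snd a"] H.in_arcsD2[of "fst a" "snd a"] by auto
    show "fst a \<noteq> snd a" if "a \<in> parcs G" for a
      using sub that H.no_loops'[of "fst a" "snd a"] by auto
  qed
  moreover have edge_set_G: "edge_set G = F"
  proof
    show "edge_set G \<subseteq> F" by (auto simp: edge_set_def G_def)
    show "F \<subseteq> edge_set G"
    proof
      fix e assume "e \<in> F"
      then obtain u v where "e = {u, v}" using F(1) by (auto simp: edge_set_def)
      then show "e \<in> edge_set G" using \<open>e \<in> F\<close> by (auto simp: edge_set_def G_def)
    qed
  qed
  moreover have more: "num_colorings H q \<le> num_colorings G q"
    unfolding num_colorings_def
  proof (rule card_mono)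
    show "proper_colorings H q \<subseteq> proper_colorings G q"
      using sub by (auto simp: proper_colorings_def)
  qed (simp add: finite_proper_colorings)
  moreover have "\<not> isomorphic G (turan_graph s n)"
    using num_colorings_le_if_isomorphic[OF \<open>pair_graph G\<close> pair_graph_turan_graph, of s n q]
      more colorings by fastforce
  ultimately have "pair_graph G \<and> card (pverts G) = card (pverts (turan_graph s n))
      \<and> card (edge_set G) = card (edge_set (turan_graph s n)) \<and> \<not> isomorphic G (turan_graph s n)"
    using H(2) F(2) by simp
  moreover have "\<not> num_colorings G q < num_colorings (turan_graph s n) q"
    using more colorings by simp
  ultimately show ?thesis
    using n unfolding lazebnik_conjecture_def by blast
qed


section \<open>Complete multipartite graphs\<close>

definition multipartite_graph :: "(nat \<Rightarrow> 'i) \<Rightarrow> nat \<Rightarrow> nat pair_pre_digraph" where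
  "multipartite_graph p n =
     \<lparr>pverts = {..<n}, parcs = {(u, v). u < n \<and> v < n \<and> p u \<noteq> p v}\<rparr>"

lemma pverts_multipartite_graph [simp]: "pverts (multipartite_graph p n) = {..<n}"
  by (simp add: multipartite_graph_def)

lemma turan_graph_eq_multipartite_graph: "turan_graph s n = multipartite_graph (\<lambda>v. v mod s) n"
  by (simp add: turan_graph_def multipartite_graph_def)

lemma pair_graph_multipartite_graph: "pair_graph (multipartite_graph p n)"
proof -
  have "finite {(u, v). u < n \<and> v < n \<and> p u \<noteq> p v}"
    by (rule finite_subset[of _ "{..<n} \<times> {..<n}"]) auto
  then show ?thesis
    by unfold_locales (auto simp: multipartite_graph_def symmetric_def sym_def)
qed

text \<open>
  Counting ordered pairs of vertices turns a comparison of edge numbers into one of sums of squared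
  part sizes.
\<close>

lemma two_card_edge_set_multipartite_graph:
  assumes "finite I" "p ` {..<n} \<subseteq> I"
  shows "2 * card (edge_set (multipartite_graph p n)) + (\<Sum>i\<in>I. (card {v \<in> {..<n}. p v = i})\<^sup>2) = n\<^sup>2"
proof -
  let ?G = "multipartite_graph p n"
  let ?S = "\<lambda>i. {v \<in> {..<n}. p v = i}"
  have "(\<Sum>i\<in>I. (card (?S i))\<^sup>2) = (\<Sum>i\<in>I. card (?S i \<times> ?S i))"
    by (simp add: card_cartesian_product power2_eq_square)
  also have "\<dots> = card (\<Union>i\<in>I. ?S i \<times> ?S i)"
    by (rule card_UN_disjoint[symmetric]) (use assms(1) in auto)
  finally have squares: "(\<Sum>i\<in>I. (card (?S i))\<^sup>2) = card (\<Union>i\<in>I. ?S i \<times> ?S i)" .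
  have "{..<n} \<times> {..<n} = parcs ?G \<union> (\<Union>i\<in>I. ?S i \<times> ?S i)"
    using assms(2) by (auto simp: multipartite_graph_def)
  moreover have "parcs ?G \<inter> (\<Union>i\<in>I. ?S i \<times> ?S i) = {}"
    by (auto simp: multipartite_graph_def)
  moreover have "finite (parcs ?G)"
    by (rule finite_subset[of _ "{..<n} \<times> {..<n}"]) (auto simp: multipartite_graph_def)
  moreover have "finite (\<Union>i\<in>I. ?S i \<times> ?S i)"
    using assms(1) by auto
  ultimately have "card ({..<n} \<times> {..<n}) = card (parcs ?G) + card (\<Union>i\<in>I. ?S i \<times> ?S i)"
    by (simp add: card_Un_disjoint)
  then show ?thesis
    using squares card_parcs_eq_twice_card_edge_set[OF pair_graph_multipartite_graph, of p n]
    by (simp add: card_cartesian_product power2_eq_square)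
qed

lemma exists_partition_with_part_sizes:
  fixes c :: "'i \<Rightarrow> nat"
  assumes "finite I"
  shows "\<exists>p. p ` {..<sum c I} \<subseteq> I \<and> (\<forall>i\<in>I. card {v \<in> {..<sum c I}. p v = i} = c i)"
proof -
  let ?A = "SIGMA i:I. {..<c i}"
  have "finite ?A" "card ?A = sum c I" using assms by auto
  then obtain h where h: "bij_betw h {..<sum c I} ?A"
    using ex_bij_betw_nat_finite[of ?A] by (auto simp: atLeast0LessThan)
  have "card {v \<in> {..<sum c I}. fst (h v) = i} = c i" if "i \<in> I" for i
  proof -
    have "h ` {v \<in> {..<sum c I}. fst (h v) = i} = {a \<in> h ` {..<sum c I}. fst a = i}"
      by auto
    also have "\<dots> = {a \<in> ?A. fst a = i}" using h by (simp add: bij_betw_def)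
    also have "\<dots> = {i} \<times> {..<c i}" using that by auto
    finally have "card (h ` {v \<in> {..<sum c I}. fst (h v) = i}) = c i"
      by (simp add: card_cartesian_product)
    moreover have "inj_on h {v \<in> {..<sum c I}. fst (h v) = i}"
      using h by (auto simp: bij_betw_def intro: inj_on_subset)
    ultimately show ?thesis by (simp add: card_image)
  qed
  moreover have "fst (h v) \<in> I" if "v \<in> {..<sum c I}" for v
    using bij_betw_apply[OF h that] by auto
  ultimately show ?thesis by (intro exI[of _ "\<lambda>v. fst (h v)"]) blast
qed

lemma prod_over_partition:
  fixes g :: "'i \<Rightarrow> nat" and p :: "nat \<Rightarrow> 'i"
  assumes "finite I" "p ` {..<n} \<subseteq> I"
  shows "(\<Prod>v<n. g (p v)) = (\<Prod>i\<in>I. g i ^ card {v \<in> {..<n}. p v = i})"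
proof -
  have "(\<Prod>v<n. g (p v)) = (\<Prod>i\<in>I. \<Prod>v\<in>{v \<in> {..<n}. p v = i}. g (p v))"
    using assms by (intro prod.group[symmetric]) auto
  also have "\<dots> = (\<Prod>i\<in>I. g i ^ card {v \<in> {..<n}. p v = i})"
    by (intro prod.cong) auto
  finally show ?thesis .
qed

text \<open>
  Reserving \<open>m i\<close> private colours for part \<open>i\<close> makes every choice of colours within the reserved
  sets a proper colouring.
\<close>

lemma num_colorings_multipartite_graph_ge:
  assumes "finite I" "p ` {..<n} \<subseteq> I"
  shows "(\<Prod>i\<in>I. m i ^ card {v \<in> {..<n}. p v = i})
    \<le> num_colorings (multipartite_graph p n) (sum m I)"
proof -
  obtain k where k: "\<forall>i\<in>I. card {x \<in> {..<sum m I}. k x = i} = m i"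
    using exists_partition_with_part_sizes[OF assms(1), of m] by blast
  let ?C = "PiE {..<n} (\<lambda>v. {x \<in> {..<sum m I}. k x = p v})"
  have "(\<Prod>i\<in>I. m i ^ card {v \<in> {..<n}. p v = i}) = (\<Prod>v<n. m (p v))"
    using prod_over_partition[OF assms] by simp
  also have "\<dots> = card ?C"
    using k assms(2) by (auto simp: card_PiE intro!: prod.cong)
  also have "\<dots> \<le> num_colorings (multipartite_graph p n) (sum m I)"
    unfolding num_colorings_def
  proof (rule card_mono)
    show "?C \<subseteq> proper_colorings (multipartite_graph p n) (sum m I)"
    proof
      fix c assume c: "c \<in> ?C"
      then have "c \<in> {..<n} \<rightarrow>\<^sub>E {..<sum m I}" by (simp add: PiE_iff)
      moreover have "c u \<noteq> c v" if "u < n" "v < n" "p u \<noteq> p v" for u v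
        using PiE_mem[OF c, of u] PiE_mem[OF c, of v] that by auto
      ultimately show "c \<in> proper_colorings (multipartite_graph p n) (sum m I)"
        by (simp add: proper_colorings_def multipartite_graph_def)
    qed
  qed (simp add: finite_proper_colorings)
  finally show ?thesis .
qed


section \<open>Colourings of the Turan graph\<close>

text \<open>
  This is concavity of the logarithm on the integers: the right-hand side, as a function of \<open>m\<close>,
  is the exponential that agrees with \<open>m\<close> at \<open>m = t\<close> and at \<open>m = t + 1\<close>.
\<close>

lemma le_secant_exponential:
  fixes m t :: nat
  assumes "0 < t"
  shows "real m \<le> real t * (1 + 1 / real t) powr (real m - real t)"
proof (cases "t \<le> m")
  case True
  then obtain k where k: "m = t + k" using le_Suc_ex by blast
  have "real m = real t * (1 + real k * (1 / real t))"
    using assms k by (simp add: field_simps)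
  also have "\<dots> \<le> real t * (1 + 1 / real t) ^ k"
    by (intro mult_left_mono Bernoulli_inequality) (auto intro: order_trans[of _ 0])
  finally show ?thesis using assms k by (simp add: powr_realpow add_pos_nonneg)
next
  case False
  then obtain j where j: "t = m + j" using le_Suc_ex nat_le_linear by blast
  have inv: "inverse (1 + 1 / real t) = 1 + - (1 / (real t + 1))"
    using assms by (simp add: field_simps)
  have "real m = real t * (1 - real j / real t)"
    using assms j by (simp add: right_diff_distrib)
  also have "\<dots> \<le> real t * (1 + real j * - (1 / (real t + 1)))"
    using assms by (intro mult_left_mono) (auto simp: field_simps)
  also have "\<dots> \<le> real t * (1 + - (1 / (real t + 1))) ^ j"
    using assms by (intro mult_left_mono Bernoulli_inequality) (auto simp: field_simps)
  also have "\<dots> = real t * inverse (1 + 1 / real t) ^ j" using inv by simp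
  also have "\<dots> = real t * (1 + 1 / real t) powr (real m - real t)"
    using assms j by (simp add: powr_minus powr_realpow add_pos_nonneg power_inverse)
  finally show ?thesis .
qed

text \<open>
  Multiplying the secant bound over all factors, the exponents add up to \<open>k\<close>; so only the sum of the
  factors matters. For \<open>k \<le> card I\<close> the bound is attained by \<open>k\<close> factors \<open>t + 1\<close> and otherwise
  factors \<open>t\<close>.
\<close>

lemma prod_le_balanced_prod:
  fixes m :: "'i \<Rightarrow> nat"
  assumes "0 < t" "finite I" "sum m I = card I * t + k"
  shows "(\<Prod>i\<in>I. real (m i)) \<le> real t ^ card I * (1 + 1 / real t) ^ k"
proof -
  let ?\<rho> = "1 + 1 / real t"
  have pos: "0 < ?\<rho>" using assms(1) by (simp add: add_pos_nonneg)
  have "(\<Prod>i\<in>I. real (m i)) \<le> (\<Prod>i\<in>I. real t * ?\<rho> powr (real (m i) - real t))"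
    using le_secant_exponential[OF assms(1)] by (intro prod_mono) auto
  also have "\<dots> = real t ^ card I * ?\<rho> powr (\<Sum>i\<in>I. real (m i) - real t)"
    using pos assms(2) by (simp add: prod.distrib powr_sum)
  also have "(\<Sum>i\<in>I. real (m i) - real t) = real (sum m I) - real (card I) * real t"
    by (simp add: sum_subtractf)
  also have "\<dots> = real k" using assms(3) by simp
  finally show ?thesis using pos by (simp add: powr_realpow)
qed

text \<open>
  In a proper colouring every colour is used in at most one part. Once it is decided which part owns
  which colour, in at most \<open>s\<^sup>q\<close> ways, the colourings are counted by a product that is largest when
  the colours are shared out evenly. The factor \<open>s\<^sup>q\<close> does not depend on the number of vertices.
\<close>

lemma num_colorings_turan_graph_le:
  assumes "0 < s" "0 < t" "q = s * t + k"
  shows "real (num_colorings (turan_graph s (s * N)) q)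
    \<le> real s ^ q * (real t ^ s * (1 + 1 / real t) ^ k) ^ N"
proof -
  let ?n = "s * N"
  let ?owners = "{..<q} \<rightarrow>\<^sub>E {..<s}"
  let ?owned = "\<lambda>f i. {x \<in> {..<q}. f x = i}"
  let ?C = "\<lambda>f :: nat \<Rightarrow> nat. PiE {..<?n} (\<lambda>v. ?owned f (v mod s))"
  have finite_owners: "finite ?owners" by (simp add: finite_PiE)
  have finite_C: "finite (?C f)" for f by (simp add: finite_PiE)
  have "proper_colorings (turan_graph s ?n) q \<subseteq> (\<Union>f\<in>?owners. ?C f)"
  proof
    fix c assume "c \<in> proper_colorings (turan_graph s ?n) q"
    then have range: "c \<in> {..<?n} \<rightarrow>\<^sub>E {..<q}"
      and proper: "\<And>u v. u < ?n \<Longrightarrow> v < ?n \<Longrightarrow> c u = c v \<Longrightarrow> u mod s = v mod s"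
      by (auto simp: proper_colorings_def turan_graph_def)
    \<comment> \<open>Unused colours belong to nobody; giving them to part \<open>0\<close> makes \<open>f\<close> total on the palette.\<close>
    define f where "f = (\<lambda>x\<in>{..<q}. if x \<in> c ` {..<?n} then inv_into {..<?n} c x mod s else 0)"
    have f: "f \<in> ?owners" using assms(1) by (simp add: f_def)
    have "c v \<in> ?owned f (v mod s)" if v: "v \<in> {..<?n}" for v
    proof -
      have "c v \<in> c ` {..<?n}" using v by (rule imageI)
      then have "inv_into {..<?n} c (c v) mod s = v mod s"
        using v inv_into_into[of "c v" c "{..<?n}"] by (intro proper) (simp_all add: f_inv_into_f)
      moreover have "c v < q" using PiE_mem[OF range v] by simp
      ultimately show ?thesis using \<open>c v \<in> c ` {..<?n}\<close> by (simp add: f_def)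
    qed
    then have "c \<in> ?C f" using range by (simp add: PiE_iff)
    then show "c \<in> (\<Union>f\<in>?owners. ?C f)" using f by (rule UN_I[rotated])
  qed
  then have "num_colorings (turan_graph s ?n) q \<le> card (\<Union>f\<in>?owners. ?C f)"
    unfolding num_colorings_def
    using finite_owners finite_C by (intro card_mono finite_UN_I)
  also have "\<dots> \<le> (\<Sum>f\<in>?owners. card (?C f))"
    using finite_owners by (rule card_UN_le)
  finally have "real (num_colorings (turan_graph s ?n) q) \<le> real (\<Sum>f\<in>?owners. card (?C f))"
    by (simp only: of_nat_le_iff)
  also have "\<dots> = (\<Sum>f\<in>?owners. real (card (?C f)))" by (rule of_nat_sum)
  also have "\<dots> \<le> real (card ?owners) * (real t ^ s * (1 + 1 / real t) ^ k) ^ N"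
  proof (rule sum_bounded_above)
    fix f assume f: "f \<in> ?owners"
    let ?m = "\<lambda>i. card (?owned f i)"
    have part: "card {v \<in> {..<?n}. v mod s = i} = N" if "i < s" for i
      using turan_graph_part_size[of s ?n i] that by (simp add: turan_graph_def)
    have "card (?C f) = (\<Prod>v<?n. ?m (v mod s))" by (simp add: card_PiE)
    also have "\<dots> = (\<Prod>i<s. ?m i ^ card {v \<in> {..<?n}. v mod s = i})"
      using assms(1) by (intro prod_over_partition) auto
    also have "\<dots> = (\<Prod>i<s. ?m i) ^ N"
      using part by (simp add: prod_power_distrib)
    finally have card_C: "real (card (?C f)) = (\<Prod>i<s. real (?m i)) ^ N" by simp
    have "f ` {..<q} \<subseteq> {..<s}" using PiE_mem[OF f] by blast
    then have "(\<Sum>i<s. \<Sum>x\<in>?owned f i. 1) = (\<Sum>x<q. 1 :: nat)"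
      by (intro sum.group) simp_all
    then have "sum ?m {..<s} = card {..<s} * t + k" using assms(3) by simp
    then have "(\<Prod>i<s. real (?m i)) \<le> real t ^ s * (1 + 1 / real t) ^ k"
      using prod_le_balanced_prod[OF assms(2), of "{..<s}" ?m k] by simp
    then show "real (card (?C f)) \<le> (real t ^ s * (1 + 1 / real t) ^ k) ^ N"
      unfolding card_C by (intro power_mono prod_nonneg) auto
  qed
  finally show ?thesis by (simp add: card_PiE)
qed


section \<open>The unbalanced graph with one extra part\<close>

lemma split_atMost:
  fixes f :: "nat \<Rightarrow> 'a::comm_semiring_1"
  assumes "r \<le> s"
  shows sum_split_atMost: "sum f {..s} = sum f {..<r} + sum f {r..<s} + f s"
    and prod_split_atMost: "prod f {..s} = prod f {..<r} * prod f {r..<s} * f s"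
proof -
  have "sum f {..s} = sum f {..<s} + f s" "prod f {..s} = prod f {..<s} * f s"
    by (simp_all flip: lessThan_Suc_atMost)
  then show "sum f {..s} = sum f {..<r} + sum f {r..<s} + f s"
    and "prod f {..s} = prod f {..<r} * prod f {r..<s} * f s"
    using sum.atLeastLessThan_concat[of 0 r s f] prod.atLeastLessThan_concat[of 0 r s f] assms
    by (simp_all add: atLeast0LessThan)
qed

text \<open>
  The shift \<open>4\<close> and the extra part \<open>y = 4 * d\<close> with \<open>d = s - 2 * r\<close> are linked by the vertex number.
  The shifts change the sum of squares by \<open>16 * s - 8 * s * d\<close>, to which the extra part adds
  \<open>16 * d\<^sup>2\<close>. The total is negative for large \<open>s\<close> only if \<open>d\<close> is at least \<open>3\<close>; a larger \<open>d\<close> makes the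
  extra part, which has only one colour, more expensive. The values \<open>3\<close> and \<open>4\<close> serve the two
  parities of \<open>s\<close>.
\<close>

lemma not_lazebnik_conjecture_if_power_less:
  fixes s t r :: nat
  assumes t: "0 < t" and s: "18 \<le> s" and r: "2 * r + 3 \<le> s" "s \<le> 2 * r + 4"
    and less: "real t ^ (4 * (s - 2 * r)) < (1 + 1 / real t) ^ (4 * r - s)"
  shows "\<not> lazebnik_conjecture s (s * t + (r + 1))"
proof -
  define q where "q = s * t + (r + 1)"
  define \<rho> where "\<rho> = 1 + 1 / real t"
  define d where "d = s - 2 * r"
  define y where "y = 4 * d"
  have d: "s = 2 * r + d" "d = 3 \<or> d = 4" using r by (auto simp: d_def)
  obtain w where w: "s = w + 4" using s by (intro that[of "s - 4"]) simp
  have "4 * r - s + s = 4 * r" using r s by linarith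
  have \<rho>: "0 < \<rho>" using t by (simp add: \<rho>_def add_pos_nonneg)
  have "1 < \<rho> ^ (4 * r - s) / real t ^ y"
    using less t by (simp add: \<rho>_def y_def d_def)
  \<comment> \<open>The blow-up factor that absorbs the number of ways to give the colours to the parts.\<close>
  then obtain M where M: "real s ^ q < (\<rho> ^ (4 * r - s) / real t ^ y) ^ M"
    using real_arch_pow by blast
  have "0 < M"
  proof (rule ccontr)
    assume "\<not> 0 < M"
    then have "real s ^ q < 1" using M by simp
    moreover have "1 \<le> real s ^ q" using s by (intro one_le_power) simp
    ultimately show False by simp
  qed

  \<comment> \<open>\<open>c i\<close> is the size of part \<open>i\<close> and \<open>m i\<close> the number of its colours; part \<open>s\<close> is the extra one.\<close>
  define c where "c i = (if i < r then M * (s + 4) else if i < s then M * (s - 4) else M * y)" for i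
  define m where "m i = (if i < r then t + 1 else if i < s then t else 1)" for i
  have "r \<le> s" using r by simp
  have total: "r * (s + 4) + (s - r) * (s - 4) + y = s * s"
  proof -
    have "s - r = r + d" "s - 4 = w" using d w by auto
    then have "int (r * (s + 4) + (s - r) * (s - 4) + y)
      = int r * (int s + 4) + (int r + int d) * (int s - 4) + 4 * int d"
      using w by (simp add: y_def)
    also have "\<dots> = int s * int s"
    proof -
      have "int s = 2 * int r + int d" using d(1) by simp
      then show ?thesis by algebra
    qed
    also have "\<dots> = int (s * s)" by simp
    finally show ?thesis by (simp only: of_nat_eq_iff)
  qed
  have squares: "r * (s + 4)\<^sup>2 + (s - r) * (s - 4)\<^sup>2 + y\<^sup>2 \<le> s * s\<^sup>2"
  proof -
    have "s - r = r + d" "s - 4 = w" using d w by auto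
    then have "int (r * (s + 4)\<^sup>2 + (s - r) * (s - 4)\<^sup>2 + y\<^sup>2)
      = int r * (int s + 4)\<^sup>2 + (int r + int d) * (int s - 4)\<^sup>2 + 16 * (int d)\<^sup>2"
      using w by (simp add: y_def power_mult_distrib)
    also have "\<dots> = int s * (int s)\<^sup>2 + 8 * (2 * int s + 2 * (int d)\<^sup>2 - int s * int d)"
    proof -
      have "int s = 2 * int r + int d" using d(1) by simp
      then show ?thesis by algebra
    qed
    also have "\<dots> \<le> int s * (int s)\<^sup>2"
      using d(2) s by (auto simp: power2_eq_square)
    also have "\<dots> = int (s * s\<^sup>2)" by simp
    finally show ?thesis by (simp only: of_nat_le_iff)
  qed
  have sum_c: "sum c {..s} = s * (s * M)"
  proof -
    have "sum c {..s} = M * (r * (s + 4) + (s - r) * (s - 4) + y)"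
      unfolding sum_split_atMost[OF \<open>r \<le> s\<close>] using \<open>r \<le> s\<close>
      by (simp add: c_def distrib_left mult_ac)
    then show ?thesis using total by simp
  qed
  have sum_c_squares: "(\<Sum>i\<le>s. (c i)\<^sup>2) \<le> s * (s * M)\<^sup>2"
  proof -
    have "(\<Sum>i\<le>s. (c i)\<^sup>2) = M\<^sup>2 * (r * (s + 4)\<^sup>2 + (s - r) * (s - 4)\<^sup>2 + y\<^sup>2)"
      unfolding sum_split_atMost[OF \<open>r \<le> s\<close>] using \<open>r \<le> s\<close>
      by (simp add: c_def power_mult_distrib) (simp add: distrib_left mult_ac)
    also have "\<dots> \<le> M\<^sup>2 * (s * s\<^sup>2)" using squares by (rule mult_left_mono) simp
    finally show ?thesis by (simp add: power_mult_distrib mult_ac)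
  qed
  have sum_m: "sum m {..s} = q"
  proof -
    have "sum m {..s} = r * (t + 1) + (s - r) * t + 1"
      unfolding sum_split_atMost[OF \<open>r \<le> s\<close>] using \<open>r \<le> s\<close> by (simp add: m_def)
    also have "s - r = r + d" using d by simp
    finally show ?thesis using d(1) by (simp add: q_def algebra_simps)
  qed

  obtain p where p: "p ` {..<s * (s * M)} \<subseteq> {..s}"
    "\<forall>i\<in>{..s}. card {v \<in> {..<s * (s * M)}. p v = i} = c i"
    using exists_partition_with_part_sizes[of "{..s}" c] unfolding sum_c by auto
  let ?n = "s * (s * M)"
  let ?H = "multipartite_graph p ?n"

  have "card (edge_set (turan_graph s ?n)) \<le> card (edge_set ?H)"
  proof -
    have part: "card {v \<in> {..<?n}. v mod s = i} = s * M" if "i < s" for i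
      using turan_graph_part_size[of s ?n i] that by (simp add: turan_graph_def)
    have "2 * card (edge_set (turan_graph s ?n)) + s * (s * M)\<^sup>2 = ?n\<^sup>2"
      using two_card_edge_set_multipartite_graph[of "{..<s}" "\<lambda>v. v mod s" ?n] part s
      by (simp add: turan_graph_eq_multipartite_graph image_subset_iff)
    moreover have "2 * card (edge_set ?H) + (\<Sum>i\<le>s. (c i)\<^sup>2) = ?n\<^sup>2"
      using two_card_edge_set_multipartite_graph[OF _ p(1)] p(2) by simp
    ultimately show ?thesis using sum_c_squares by linarith
  qed
  moreover have "num_colorings (turan_graph s ?n) q < num_colorings ?H q"
  proof -
    have "(\<Prod>i\<le>s. m i ^ c i) \<le> num_colorings ?H q"
      using num_colorings_multipartite_graph_ge[OF _ p(1), of m] p(2) sum_m by simp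
    then have lower: "real (\<Prod>i\<le>s. m i ^ c i) \<le> real (num_colorings ?H q)"
      by (simp only: of_nat_le_iff)
    have t\<rho>: "1 + real t = \<rho> * real t" using t by (simp add: \<rho>_def field_simps)
    have "(\<Prod>i\<le>s. m i ^ c i) = ((t + 1) ^ (M * (s + 4))) ^ r * (t ^ (M * (s - 4))) ^ (s - r)"
      unfolding prod_split_atMost[OF \<open>r \<le> s\<close>] using \<open>r \<le> s\<close> by (simp add: m_def c_def)
    also have "\<dots> = ((t + 1) ^ (r * (s + 4)) * t ^ ((s - r) * (s - 4))) ^ M"
      by (simp add: power_mult_distrib power_mult[symmetric] mult_ac)
    also have "real \<dots> = (\<rho> ^ (r * (s + 4)) * real t ^ (r * (s + 4) + (s - r) * (s - 4))) ^ M"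
      by (simp add: t\<rho> power_mult_distrib power_add mult_ac)
    also have "r * (s + 4) + (s - r) * (s - 4) = s * s - y"
      using total by simp
    also have "r * (s + 4) = s * (r + 1) + (4 * r - s)"
      using \<open>4 * r - s + s = 4 * r\<close> by (simp add: algebra_simps)
    finally have prod_eq: "real (\<Prod>i\<le>s. m i ^ c i)
      = (\<rho> ^ (s * (r + 1) + (4 * r - s)) * real t ^ (s * s - y)) ^ M" .
    have "y \<le> s * s" using total by simp
    then have t_split: "real t ^ (s * s) = real t ^ (s * s - y) * real t ^ y"
      by (simp add: power_add[symmetric])

    have "real (num_colorings (turan_graph s ?n) q)
      \<le> real s ^ q * (real t ^ s * \<rho> ^ (r + 1)) ^ (s * M)"
      unfolding \<rho>_def using s t by (intro num_colorings_turan_graph_le) (auto simp: q_def)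
    also have "(real t ^ s * \<rho> ^ (r + 1)) ^ (s * M) = (real t ^ (s * s) * \<rho> ^ (s * (r + 1))) ^ M"
      by (simp only: power_mult_distrib power_mult[symmetric] mult_ac)
    also have "real s ^ q * \<dots>
      < (\<rho> ^ (4 * r - s) / real t ^ y) ^ M * (real t ^ (s * s) * \<rho> ^ (s * (r + 1))) ^ M"
      using M t \<rho> by (intro mult_strict_right_mono) auto
    also have "\<dots> = (\<rho> ^ (s * (r + 1) + (4 * r - s)) * real t ^ (s * s - y)) ^ M"
      using t unfolding t_split power_mult_distrib[symmetric] power_add by (simp add: mult_ac)
    also have "\<dots> \<le> real (num_colorings ?H q)" using lower prod_eq by simp
    finally show ?thesis by simp
  qed
  ultimately show ?thesis
    using \<open>0 < M\<close> s
    by (intro not_lazebnik_conjectureI[of ?n, where H = ?H])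
      (auto simp: q_def pair_graph_multipartite_graph)
qed


section \<open>The range of the number of colours\<close>

theorem theorem1p3:
  fixes s q0 :: nat
  assumes "50000 \<le> s"
    and "20 * s \<le> q0"
    and "real q0 \<le> (real s)\<^sup>2 / (200 * ln (real s))"
  shows "\<exists>q :: nat. \<bar>int q - int q0\<bar> \<le> int s \<and> \<not> lazebnik_conjecture s q"
proof -
  define t where "t = q0 div s"
  \<comment> \<open>The largest \<open>r\<close> with \<open>s - 2 * r \<ge> 3\<close>.\<close>
  define r where "r = (s - 3) div 2"
  have r: "2 * r + 3 \<le> s" "s \<le> 2 * r + 4" using assms(1) by (auto simp: r_def)
  have t20: "20 \<le> t"
    using assms(1,2) by (simp add: t_def less_eq_div_iff_mult_less_eq)
  have q0: "q0 = s * t + q0 mod s" by (simp add: t_def)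
  have "0 < ln (real s)" using assms(1) by simp
  have "real s * real t \<le> real q0"
    using q0 by (metis le_add1 of_nat_le_iff of_nat_mult)
  also have "\<dots> \<le> real s * (real s / (200 * ln (real s)))"
    using assms(3) by (simp add: power2_eq_square)
  finally have "real t \<le> real s / (200 * ln (real s))"
    by (rule mult_left_le_imp_le) (use assms(1) in simp)
  then have t_ln: "200 * (real t * ln (real s)) \<le> real s"
    using \<open>0 < ln (real s)\<close> by (simp add: field_simps)

  have "real t ^ (4 * (s - 2 * r)) < (1 + 1 / real t) ^ (4 * r - s)"
  proof -
    have "t \<le> s"
    proof -
      have "1 \<le> ln (real s)"
        using assms(1) exp_le by (subst ln_ge_iff) auto
      then have "real t * 1 \<le> real t * ln (real s)" by (intro mult_left_mono) auto
      then show ?thesis using t_ln by linarith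
    qed
    have "ln (real t) \<le> ln (real s)" using \<open>t \<le> s\<close> t20 by simp
    have "real (4 * (s - 2 * r)) * ln (real t) \<le> 16 * ln (real s)"
      using r t20 \<open>ln (real t) \<le> ln (real s)\<close> by (intro mult_mono) auto
    also have "\<dots> < (real s - 8) * (1 / (real t + 1))"
    proof -
      have "16 * ln (real s) * (real t + 1) \<le> 16 * ln (real s) * (2 * real t)"
        using t20 \<open>0 < ln (real s)\<close> by (intro mult_left_mono) auto
      also have "\<dots> < real s - 8" using t_ln assms(1) by (simp add: mult_ac)
      finally show ?thesis by (simp add: field_simps)
    qed
    also have "\<dots> \<le> real (4 * r - s) * ln (1 + 1 / real t)"
    proof (intro mult_mono)
      show "real s - 8 \<le> real (4 * r - s)" using r assms(1) by linarith
      \<comment> \<open>The logarithm inequality is applied to the reciprocal of \<open>1 + 1 / t\<close>.\<close>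
      have "ln (real t / (real t + 1)) \<le> real t / (real t + 1) - 1"
        using t20 by (intro ln_le_minus_one) auto
      moreover have "ln (1 + 1 / real t) = - ln (real t / (real t + 1))"
        using t20 by (simp add: ln_div[symmetric] ln_inverse[symmetric] field_simps)
      ultimately show "1 / (real t + 1) \<le> ln (1 + 1 / real t)"
        by (simp add: field_simps)
    qed auto
    finally have "ln (real t ^ (4 * (s - 2 * r))) < ln ((1 + 1 / real t) ^ (4 * r - s))"
      using t20 by (simp add: ln_realpow add_pos_nonneg)
    then show ?thesis using t20 by (subst (asm) ln_less_cancel_iff) (auto simp: add_pos_nonneg)
  qed
  then have "\<not> lazebnik_conjecture s (s * t + (r + 1))"
    using assms(1) t20 r by (intro not_lazebnik_conjecture_if_power_less) auto
  moreover have "\<bar>int (s * t + (r + 1)) - int q0\<bar> \<le> int s"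
  proof -
    have "q0 mod s < s" using assms(1) by simp
    then show ?thesis using q0 r(1) by linarith
  qed
  ultimately show ?thesis by blast
qed

end
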